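(* Let $A,C\in\mathcal{B}(\mathcal{H})$ be commuting operators on a complex Hilbert space $\mathcal{H}$ such that $A$ is positive and invertible, $\|C\|\le1$, and $I+A(A-2I)C^*C$ is invertible. Put $B=(I+A(A-2I)C^*C)^{-1/2}$, $D=(I-C^*C)^{1/2}$, $D_*=(I-CC^* )^{1/2}$, $T=ABDC$, and $T_n=A^{-1/2}T^nA^{-1/2}=A^{n-1}(BDC)^n$ for $n\ge1$. Define $R$ on $\mathcal{H}\oplus\mathcal{H}$ by $$R=\begin{bmatrix}BDC&BDD_*\\(A-I)CBC&(A-I)CBD_*\end{bmatrix}.$$ Then $R$ is a partial isometry and, identifying $\mathcal{H}$ with the first summand of $\mathcal{H}\oplus\mathcal{H}$, $T_n=P_{\mathcal{H}}R^n|_{\mathcal{H}}$ for all $n\ge1$.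
   Context: $P_{\mathcal{H}}$ is the orthogonal projection of $\mathcal{H}\oplus\mathcal{H}$ onto its first summand. Under the stated hypotheses $I+A(A-2I)C^*C=I-C^*C+(A-I)^2C^*C$ is a positive operator, so $B$ is well defined. *)

theory Defs
  imports "HOL-Analysis.Analysis"
begin

section \<open>Complex Hilbert spaces\<close>

text \<open>
  The library has real inner product spaces but no complex ones.  Positive definiteness of the
  inner product is contained in the last axiom, completeness in the superclass \<^class>\<open>banach\<close>.
  The inner product is linear in its first argument.
\<close>

class complex_hilbert = banach +
  fixes scaleC :: "complex \<Rightarrow> 'a \<Rightarrow> 'a"  (infixr \<open>*\<^sub>C\<close> 75)
    and cinner :: "'a \<Rightarrow> 'a \<Rightarrow> complex"
  assumes scaleC_add_right: "c *\<^sub>C (x + y) = c *\<^sub>C x + c *\<^sub>C y"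
    and scaleC_add_left: "(c + d) *\<^sub>C x = c *\<^sub>C x + d *\<^sub>C x"
    and scaleC_scaleC: "c *\<^sub>C (d *\<^sub>C x) = (c * d) *\<^sub>C x"
    and scaleR_scaleC: "r *\<^sub>R x = complex_of_real r *\<^sub>C x"
    and cinner_commute: "cinner y x = cnj (cinner x y)"
    and cinner_add_left: "cinner (x + y) z = cinner x z + cinner y z"
    and cinner_scaleC_left: "cinner (c *\<^sub>C x) y = c * cinner x y"
    and cinner_same: "cinner x x = complex_of_real ((norm x)\<^sup>2)"

text \<open>The Hilbert space direct sum; its norm is the one the library puts on products.\<close>

instantiation prod :: (complex_hilbert, complex_hilbert) complex_hilbert
begin

definition scaleC_prod :: "complex \<Rightarrow> 'a \<times> 'b \<Rightarrow> 'a \<times> 'b"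
  where "scaleC_prod c z = (c *\<^sub>C fst z, c *\<^sub>C snd z)"

definition cinner_prod :: "'a \<times> 'b \<Rightarrow> 'a \<times> 'b \<Rightarrow> complex"
  where "cinner_prod z w = cinner (fst z) (fst w) + cinner (snd z) (snd w)"

instance
proof
  fix z w v :: "'a \<times> 'b" and c d :: complex and r :: real
  show "c *\<^sub>C (z + w) = c *\<^sub>C z + c *\<^sub>C w"
    by (simp add: scaleC_prod_def scaleC_add_right)
  show "(c + d) *\<^sub>C z = c *\<^sub>C z + d *\<^sub>C z"
    by (simp add: scaleC_prod_def scaleC_add_left)
  show "c *\<^sub>C (d *\<^sub>C z) = (c * d) *\<^sub>C z"
    by (simp add: scaleC_prod_def scaleC_scaleC)
  show "r *\<^sub>R z = complex_of_real r *\<^sub>C z"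
    by (simp add: scaleC_prod_def scaleR_prod_def scaleR_scaleC)
  show "cinner w z = cnj (cinner z w)"
    unfolding cinner_prod_def complex_cnj_add
    by (metis cinner_commute)
  show "cinner (z + w) v = cinner z v + cinner w v"
    by (simp add: cinner_prod_def cinner_add_left)
  show "cinner (c *\<^sub>C z) w = c * cinner z w"
    by (simp add: cinner_prod_def scaleC_prod_def cinner_scaleC_left distrib_left)
  show "cinner z z = complex_of_real ((norm z)\<^sup>2)"
    by (simp add: cinner_prod_def cinner_same norm_prod_def)
qed

end


section \<open>Bounded operators\<close>

text \<open>
  The type \<^typ>\<open>'a \<Rightarrow>\<^sub>L 'b\<close> consists of the bounded real-linear maps; the bounded operators of a
  complex Hilbert space are those among them that are complex-linear.  Composition \<open>o\<^sub>L\<close> binds weaker than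
  \<open>+\<close> and \<open>-\<close>.
\<close>

definition complex_linear :: "('a::complex_hilbert \<Rightarrow>\<^sub>L 'b::complex_hilbert) \<Rightarrow> bool"
  where "complex_linear F \<longleftrightarrow> (\<forall>c x. F (c *\<^sub>C x) = c *\<^sub>C F x)"

definition cadjoint :: "('a::complex_hilbert \<Rightarrow>\<^sub>L 'b::complex_hilbert) \<Rightarrow> ('b \<Rightarrow>\<^sub>L 'a)"
  where "cadjoint F = (THE G :: 'b \<Rightarrow>\<^sub>L 'a. \<forall>x y. cinner (F x) y = cinner x (G y))"

definition positive_op :: "('a::complex_hilbert \<Rightarrow>\<^sub>L 'a) \<Rightarrow> bool"
  where "positive_op P \<longleftrightarrow> complex_linear P \<and> (\<forall>x. cinner (P x) x \<in> \<real>\<^sub>\<ge>\<^sub>0)"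

text \<open>The positive square root; meaningful for positive operators only.\<close>

definition op_sqrt :: "('a::complex_hilbert \<Rightarrow>\<^sub>L 'a) \<Rightarrow> ('a \<Rightarrow>\<^sub>L 'a)"
  where "op_sqrt P = (THE S. positive_op S \<and> S o\<^sub>L S = P)"

text \<open>The inverse of a complex-linear operator is automatically complex-linear.\<close>

definition invertible_op :: "('a::real_normed_vector \<Rightarrow>\<^sub>L 'a) \<Rightarrow> bool"
  where "invertible_op F \<longleftrightarrow> (\<exists>G. F o\<^sub>L G = id_blinfun \<and> G o\<^sub>L F = id_blinfun)"

definition op_inverse :: "('a::real_normed_vector \<Rightarrow>\<^sub>L 'a) \<Rightarrow> ('a \<Rightarrow>\<^sub>L 'a)"
  where "op_inverse F = (THE G. F o\<^sub>L G = id_blinfun \<and> G o\<^sub>L F = id_blinfun)"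

text \<open>The power $P^{-1/2}$ of a positive invertible operator $P$.\<close>

definition op_inv_sqrt :: "('a::complex_hilbert \<Rightarrow>\<^sub>L 'a) \<Rightarrow> ('a \<Rightarrow>\<^sub>L 'a)"
  where "op_inv_sqrt P = op_inverse (op_sqrt P)"

primrec op_power :: "('a::real_normed_vector \<Rightarrow>\<^sub>L 'a) \<Rightarrow> nat \<Rightarrow> ('a \<Rightarrow>\<^sub>L 'a)"  (infixr \<open>^\<^sub>L\<close> 80)
  where
    "F ^\<^sub>L 0 = id_blinfun"
  | "F ^\<^sub>L Suc n = F o\<^sub>L (F ^\<^sub>L n)"

definition orthogonal_compl :: "'a::complex_hilbert set \<Rightarrow> 'a set"
  where "orthogonal_compl M = {x. \<forall>y\<in>M. cinner x y = 0}"

definition partial_isometry :: "('a::complex_hilbert \<Rightarrow>\<^sub>L 'b::complex_hilbert) \<Rightarrow> bool"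
  where "partial_isometry F \<longleftrightarrow>
    complex_linear F \<and> (\<forall>x \<in> orthogonal_compl {y. F y = 0}. norm (F x) = norm x)"


section \<open>Operators on the direct sum\<close>

text \<open>\<open>block_op P Q S U\<close> is the operator with first row \<open>P, Q\<close> and second row \<open>S, U\<close>.\<close>

definition block_op ::
  "('a::real_normed_vector \<Rightarrow>\<^sub>L 'a) \<Rightarrow> ('a \<Rightarrow>\<^sub>L 'a) \<Rightarrow> ('a \<Rightarrow>\<^sub>L 'a) \<Rightarrow> ('a \<Rightarrow>\<^sub>L 'a)
    \<Rightarrow> ('a \<times> 'a) \<Rightarrow>\<^sub>L ('a \<times> 'a)"
  where "block_op P Q S U = Blinfun (\<lambda>(x, y). (P x + Q y, S x + U y))"

lemma block_op_apply: "block_op P Q S U (x, y) = (P x + Q y, S x + U y)"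
proof -
  have "bounded_linear (\<lambda>z. (P (fst z) + Q (snd z), S (fst z) + U (snd z)))"
    by (intro bounded_linear_intros)
  then show ?thesis
    by (simp add: block_op_def case_prod_unfold bounded_linear_Blinfun_apply)
qed

text \<open>The first summand is identified with the set of all pairs \<open>(h, 0)\<close>.\<close>

definition proj_first :: "('a::real_normed_vector \<times> 'a) \<Rightarrow>\<^sub>L ('a \<times> 'a)"
  where "proj_first = Blinfun (\<lambda>(x, y). (x, 0))"

lemma proj_first_apply: "proj_first (x, y) = (x, 0)"
proof -
  have "bounded_linear (\<lambda>z :: 'a \<times> 'a. (fst z, 0 :: 'a))"
    by (intro bounded_linear_intros)
  then show ?thesis
    by (simp add: proj_first_def case_prod_unfold bounded_linear_Blinfun_apply)
qed

end

theory Submission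
  imports Defs
begin

text \<open>
  Put \<open>E = A - I\<close>.  The operator \<open>R\<close> factors as \<open>V W\<close> with the column \<open>V = (B D, E C B)\<close> and the row
  \<open>W = (C, D\<^sub>*)\<close>.  Since \<open>A\<close> commutes with \<open>B, C, D\<close> and their adjoints, \<open>B\<close> commutes with \<open>D\<close> and
  \<open>B\<^sup>-\<^sup>2 = D\<^sup>2 + C\<^sup>* E\<^sup>2 C\<close>, the column is isometric; the row satisfies \<open>W W\<^sup>* = C C\<^sup>* + D\<^sub>*\<^sup>2 = I\<close>.  Hence
  \<open>R\<close> is a partial isometry.  The intertwining relation \<open>C D = D\<^sub>* C\<close> gives \<open>W V = A C B D\<close>, so
  \<open>R\<^sup>n = V (A C B D)\<^sup>n\<^sup>-\<^sup>1 W\<close>, which yields the compression.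
\<close>

section \<open>Calculus of the complex inner product and the Cauchy-Schwarz inequality\<close>

lemma cinner_scaleR_left: "cinner (r *\<^sub>R x) y = r *\<^sub>R cinner x y"
  by (simp add: scaleR_scaleC cinner_scaleC_left scaleR_conv_of_real)

lemma cinner_add_right: "cinner x (y + z) = cinner x y + cinner x z"
  by (metis cinner_add_left cinner_commute complex_cnj_add)

lemma cinner_scaleC_right: "cinner x (c *\<^sub>C y) = cnj c * cinner x y"
  by (metis cinner_scaleC_left cinner_commute complex_cnj_mult)

lemma cinner_scaleR_right: "cinner x (r *\<^sub>R y) = r *\<^sub>R cinner x y"
  by (simp add: scaleR_scaleC cinner_scaleC_right scaleR_conv_of_real)

lemma Re_cinner_commute: "Re (cinner x y) = Re (cinner y x)"
  by (metis cinner_commute cnj.simps(1))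

lemma Re_cinner_same: "Re (cinner x x) = (norm x)\<^sup>2"
  by (simp add: cinner_same)

lemma norm_scaleC: "norm (c *\<^sub>C x) = cmod c * norm x"
proof -
  have "complex_of_real ((norm (c *\<^sub>C x))\<^sup>2) = complex_of_real ((cmod c * norm x)\<^sup>2)"
    unfolding cinner_same[symmetric] cinner_scaleC_left cinner_scaleC_right
    unfolding power_mult_distrib of_real_mult complex_norm_square cinner_same by simp
  then show ?thesis
    by (simp add: flip: of_real_power)
qed

lemma norm_add_power2: "(norm (x + y))\<^sup>2 = (norm x)\<^sup>2 + 2 * Re (cinner x y) + (norm y)\<^sup>2"
  for x y :: "'a::complex_hilbert"
  unfolding Re_cinner_same[symmetric] cinner_add_left cinner_add_right
  using Re_cinner_commute[of x y] by simp

text \<open>The squared norm of \<open>norm y *\<^sub>R x - norm x *\<^sub>R y\<close> is the defect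
  \<open>norm x * norm y - Re (cinner x y)\<close> times \<open>2 * (norm x * norm y)\<close>, and
  this factor is positive once both vectors are nonzero.\<close>

lemma Re_cinner_le_norm: "Re (cinner x y) \<le> norm x * norm y"
proof (cases "x = 0 \<or> y = 0")
  case True
  then show ?thesis
    using cinner_scaleR_left[of 0 x y] cinner_scaleR_right[of x 0 y] by auto
next
  case False
  have "0 \<le> (norm (norm y *\<^sub>R x + (- norm x) *\<^sub>R y))\<^sup>2"
    by (rule zero_le_power2)
  also have "\<dots> = 2 * (norm x * norm y) * (norm x * norm y - Re (cinner x y))"
    unfolding norm_add_power2 cinner_scaleR_left cinner_scaleR_right
    by (simp add: power_mult_distrib algebra_simps power2_eq_square)
  finally show ?thesis
    using False by (simp add: zero_le_mult_iff mult_le_0_iff)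
qed

text \<open>Multiplying \<open>x\<close> by the conjugate phase of \<open>cinner x y\<close> makes
  the inner product real and nonnegative, which reduces the claim to the real part. If the inner
  product vanishes, \<open>sgn\<close> gives the factor \<open>0\<close>, and the argument still
  goes through.\<close>

lemma norm_cinner_le_norm: "norm (cinner x y) \<le> norm x * norm y"
proof -
  define c where "c = cnj (sgn (cinner x y))"
  have "c * cinner x y = complex_of_real (norm (cinner x y))"
    by (simp add: c_def sgn_div_norm scaleR_conv_of_real power2_eq_square divide_simps
        complex_norm_square[symmetric] mult.commute[of "cnj _"] flip: of_real_mult)
  then have "norm (cinner x y) = Re (cinner (c *\<^sub>C x) y)"
    by (simp add: cinner_scaleC_left)
  also have "\<dots> \<le> norm (c *\<^sub>C x) * norm y"
    by (rule Re_cinner_le_norm)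
  also have "\<dots> \<le> norm x * norm y"
    by (simp add: norm_scaleC c_def norm_sgn mult_right_mono)
  finally show ?thesis .
qed

lemma bounded_bilinear_cinner: "bounded_bilinear (cinner :: 'a::complex_hilbert \<Rightarrow> _)"
  by (rule bounded_bilinear.intro)
    (auto simp: cinner_add_left cinner_add_right cinner_scaleR_left cinner_scaleR_right
      intro!: exI[of _ 1] norm_cinner_le_norm)

interpretation cinner: bounded_bilinear "cinner :: 'a::complex_hilbert \<Rightarrow> 'a \<Rightarrow> complex"
  by (rule bounded_bilinear_cinner)

lemma cinner_eqI:
  assumes "\<And>z. cinner x z = cinner y z"
  shows "x = (y :: 'a::complex_hilbert)"
proof -
  have "cinner (x - y) (x - y) = 0"
    by (simp add: cinner.diff_left assms)
  then show ?thesis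
    by (simp add: cinner_same)
qed

lemma cinner_eqI':
  assumes "\<And>z. cinner z x = cinner z y"
  shows "x = (y :: 'a::complex_hilbert)"
  by (metis assms cinner_commute cinner_eqI)

text \<open>The representing vector minimises \<open>\<parallel>x\<parallel>\<^sup>2 / 2 - f x\<close>.\<close>

lemma riesz_representation_real:
  fixes f :: "'a::complex_hilbert \<Rightarrow> real"
  assumes "bounded_linear f"
  obtains x where "\<And>y. f y = Re (cinner x y)"
proof -
  interpret f: bounded_linear f by fact
  obtain K where K: "\<And>x. norm (f x) \<le> norm x * K"
    using f.bounded by blast
  define \<phi> where "\<phi> x = (norm x)\<^sup>2 / 2 - f x" for x
  have lower: "- (K\<^sup>2 / 2) \<le> \<phi> x" for x
  proof -
    have "0 \<le> (norm x - K)\<^sup>2" by simp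
    moreover have "f x \<le> norm x * K" using K[of x] by simp
    ultimately show ?thesis
      by (simp add: \<phi>_def power2_eq_square algebra_simps)
  qed
  then have bdd: "bdd_below (range \<phi>)"
    by (intro bdd_belowI2[where m = "- (K\<^sup>2 / 2)"])
  define m where "m = Inf (range \<phi>)"
  have m_le: "m \<le> \<phi> x" for x
    unfolding m_def by (rule cInf_lower[OF _ bdd]) simp
  have "\<exists>x. \<phi> x < m + 1 / Suc n" for n
  proof -
    have "m < m + 1 / Suc n" by simp
    then show ?thesis
      unfolding m_def using cInf_less_iff[OF _ bdd] by blast
  qed
  then obtain X where X: "\<And>n. \<phi> (X n) < m + 1 / Suc n"
    by metis
  \<comment> \<open>The parallelogram law in terms of \<open>\<phi>\<close>: the linear parts
    cancel, because \<open>f\<close> at the midpoint is the mean of its values at \<open>x\<close>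
    and \<open>y\<close>.\<close>
  have par: "(norm (x - y))\<^sup>2 = 4 * (\<phi> x + \<phi> y - 2 * \<phi> ((1/2) *\<^sub>R (x + y)))" for x y
    unfolding \<phi>_def f.scaleR f.add norm_scaleR power_mult_distrib
    using norm_add_power2[of x y] norm_add_power2[of x "- y"]
    by (simp add: cinner.minus_right power2_eq_square field_simps)
  \<comment> \<open>The midpoint value is at least \<open>m\<close>, so only the excesses of the two
    terms over the infimum remain. This makes every minimising sequence Cauchy.\<close>
  have close: "(norm (X p - X q))\<^sup>2 \<le> 4 * (1 / Suc p + 1 / Suc q)" for p q
    using X[of p] X[of q] m_le[of "(1/2) *\<^sub>R (X p + X q)"]
    unfolding par distrib_left right_diff_distrib by argo
  have "Cauchy X"
  proof (rule CauchyI)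
    fix e :: real assume "e > 0"
    then obtain N where N: "8 / e\<^sup>2 < real N"
      using reals_Archimedean2 by blast
    have "norm (X p - X q) < e" if "p \<ge> N" "q \<ge> N" for p q
    proof -
      have "8 / e\<^sup>2 < real (Suc N)" using N by simp
      then have N': "8 / Suc N < e\<^sup>2"
        using \<open>e > 0\<close> by (simp add: field_simps)
      have "1 / real (Suc p) \<le> 1 / Suc N" "1 / real (Suc q) \<le> 1 / Suc N"
        using that by (auto intro!: divide_left_mono)
      then have "(norm (X p - X q))\<^sup>2 < e\<^sup>2"
        using close[of p q] N' by simp
      then show ?thesis
        using \<open>e > 0\<close> by (simp add: power2_less_imp_less)
    qed
    then show "\<exists>M. \<forall>m\<ge>M. \<forall>n\<ge>M. norm (X m - X n) < e" by blast
  qed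
  then obtain x where x: "X \<longlonglongrightarrow> x"
    by (auto simp: Cauchy_convergent_iff convergent_def)
  have "(\<lambda>n. \<phi> (X n)) \<longlonglongrightarrow> \<phi> x"
    unfolding \<phi>_def by (intro tendsto_intros f.tendsto x) simp
  moreover have "(\<lambda>n. m + 1 / Suc n) \<longlonglongrightarrow> m + 0"
    by (intro tendsto_intros LIMSEQ_Suc[OF lim_1_over_n])
  ultimately have "\<phi> x \<le> m + 0"
    by (rule LIMSEQ_le) (use X less_imp_le in blast)
  then have min: "\<phi> x \<le> \<phi> y" for y
    using m_le[of y] by simp
  have "f y = Re (cinner x y)" for y
  proof -
    define d where "d = Re (cinner x y) - f y"
    have quad: "0 \<le> t * d + t\<^sup>2 * (norm y)\<^sup>2 / 2" for t
      using min[of "x + t *\<^sub>R y"]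
      by (simp add: \<phi>_def d_def norm_add_power2 f.add f.scaleR cinner_scaleR_right
          power_mult_distrib algebra_simps add_divide_distrib)
    \<comment> \<open>The test value will be \<open>t = - d / s\<close>. The summand
      \<open>1\<close> keeps \<open>s\<close> positive also for \<open>y = 0\<close>, and
      \<open>s\<close> exceeds half the squared norm of \<open>y\<close>, so the quadratic is
      negative at \<open>t\<close> unless \<open>d = 0\<close>.\<close>
    define s where "s = (norm y)\<^sup>2 + 1"
    have s: "s > 0" by (simp add: s_def add_nonneg_pos)
    have "0 \<le> s\<^sup>2 * ((- d / s) * d + (- d / s)\<^sup>2 * (norm y)\<^sup>2 / 2)"
      using quad[of "- d / s"] by simp
    also have "\<dots> = - d\<^sup>2 * (s - (norm y)\<^sup>2 / 2)"
      using s by (simp add: field_simps power2_eq_square)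
    finally have "d\<^sup>2 * (s - (norm y)\<^sup>2 / 2) \<le> 0"
      by simp
    moreover have "s - (norm y)\<^sup>2 / 2 > 0"
      unfolding s_def by (simp add: field_simps add_pos_nonneg)
    ultimately have "d\<^sup>2 \<le> 0"
      by (metis mult_le_0_iff not_less zero_le_power2 order_antisym_conv order_refl)
    then show ?thesis
      by (simp add: d_def)
  qed
  then show thesis
    by (rule that)
qed

section \<open>Adjoints of complex-linear operators\<close>

lemma complex_linearD: "complex_linear F \<Longrightarrow> F (c *\<^sub>C x) = c *\<^sub>C F x"
  by (simp add: complex_linear_def)

text \<open>For fixed \<open>y\<close>, the value of the adjoint at \<open>y\<close> is the Riesz
  vector of the real functional given by the real part of \<open>cinner (F x) y\<close>. Boundedness
  comes from evaluating at \<open>x = g y\<close>.\<close>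

lemma ex_cadjoint:
  fixes F :: "'a::complex_hilbert \<Rightarrow>\<^sub>L 'b::complex_hilbert"
  assumes F: "complex_linear F"
  shows "\<exists>G :: 'b \<Rightarrow>\<^sub>L 'a. \<forall>x y. cinner (F x) y = cinner x (G y)"
proof -
  have "\<exists>z. \<forall>x. Re (cinner (F x) y) = Re (cinner z x)" for y
  proof (rule riesz_representation_real)
    show "bounded_linear (\<lambda>x. Re (cinner (F x) y))"
      by (intro bounded_linear_intros bounded_linear_compose[OF cinner.bounded_linear_left]
          bounded_linear_compose[OF bounded_linear_Re])
  qed blast
  then obtain g where "\<And>x y. Re (cinner (F x) y) = Re (cinner (g y) x)"
    by metis
  then have Re_g: "Re (cinner (F x) y) = Re (cinner x (g y))" for x y
    by (metis Re_cinner_commute)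
  have g: "cinner (F x) y = cinner x (g y)" for x y
  proof (rule complex_eqI)
    \<comment> \<open>Replacing \<open>x\<close> by \<open>\<i> *\<^sub>C x\<close> turns the
      imaginary part into a real part up to sign; complex linearity of \<open>F\<close> enters
      here.\<close>
    show "Im (cinner (F x) y) = Im (cinner x (g y))"
      using Re_g[of "\<i> *\<^sub>C x" y] by (simp add: complex_linearD[OF F] cinner_scaleC_left)
  qed (rule Re_g)
  have "bounded_linear g"
  proof
    show "g (x + y) = g x + g y" for x y
      by (rule cinner_eqI') (simp add: cinner_add_right flip: g)
    show "g (r *\<^sub>R x) = r *\<^sub>R g x" for r x
      by (rule cinner_eqI') (simp add: cinner_scaleR_right flip: g)
    have "norm (g y) \<le> norm y * norm F" for y
    proof (cases "g y = 0")
      case False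
      have "norm (g y) * norm (g y) = Re (cinner (F (g y)) y)"
        by (simp add: g Re_cinner_same power2_eq_square)
      also have "\<dots> \<le> norm (F (g y)) * norm y"
        by (rule Re_cinner_le_norm)
      also have "\<dots> \<le> norm F * norm (g y) * norm y"
        by (intro mult_right_mono norm_blinfun) simp
      finally show ?thesis
        using False by (simp add: mult_ac)
    qed simp
    then show "\<exists>K. \<forall>x. norm (g x) \<le> norm x * K" by blast
  qed
  then have "\<forall>x y. cinner (F x) y = cinner x (Blinfun g y)"
    by (simp add: bounded_linear_Blinfun_apply g)
  then show ?thesis by blast
qed

text \<open>Nondegeneracy of the inner product leaves only one candidate, so the definite
  description denotes the operator obtained from \<open>ex_cadjoint\<close>.\<close>

lemma cinner_cadjoint:
  assumes "complex_linear F"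
  shows "cinner (F x) y = cinner x (cadjoint F y)"
proof -
  obtain G where G: "\<forall>x y. cinner (F x) y = cinner x (blinfun_apply G y)"
    using ex_cadjoint[OF assms] by blast
  have "\<forall>x y. cinner (F x) y = cinner x (cadjoint F y)"
    unfolding cadjoint_def
  proof (rule theI)
    fix G' assume "\<forall>x y. cinner (F x) y = cinner x (blinfun_apply G' y)"
    then show "G' = G"
      using G by (intro blinfun_eqI cinner_eqI') metis
  qed (rule G)
  then show ?thesis by blast
qed

lemma cinner_cadjoint':
  assumes "complex_linear F"
  shows "cinner (cadjoint F x) y = cinner x (F y)"
  by (metis cinner_cadjoint[OF assms] cinner_commute)

lemma complex_linear_cadjoint:
  assumes "complex_linear F"
  shows "complex_linear (cadjoint F)"
  unfolding complex_linear_def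
  by (intro allI cinner_eqI) (simp add: cinner_cadjoint'[OF assms] cinner_scaleC_left)

lemma norm_cadjoint_apply_le:
  assumes "complex_linear F"
  shows "norm (cadjoint F x) \<le> norm F * norm x"
proof (cases "cadjoint F x = 0")
  case False
  let ?y = "cadjoint F x"
  have "norm ?y * norm ?y = Re (cinner (F ?y) x)"
    by (simp add: cinner_cadjoint[OF assms] Re_cinner_same power2_eq_square)
  also have "\<dots> \<le> norm (F ?y) * norm x"
    by (rule Re_cinner_le_norm)
  also have "\<dots> \<le> norm F * norm ?y * norm x"
    by (intro mult_right_mono norm_blinfun) simp
  finally show ?thesis
    using False by (simp add: mult_ac)
qed simp


section \<open>Positive operators\<close>

lemma positive_op_complex_linear: "positive_op P \<Longrightarrow> complex_linear P"
  by (simp add: positive_op_def)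

lemma positive_op_Re_nonneg: "positive_op P \<Longrightarrow> 0 \<le> Re (cinner (P x) x)"
  by (simp add: positive_op_def complex_nonneg_Reals_iff)

text \<open>Polarisation: the quadratic form is real at \<open>u + v\<close>, so the imaginary part
  of \<open>cinner (P u) v\<close> is antisymmetric in \<open>u\<close> and \<open>v\<close>. The
  substitution of \<open>\<i> *\<^sub>C x\<close> for \<open>x\<close> then yields the symmetry of
  the real part.\<close>

lemma positive_op_symmetric:
  assumes "positive_op P"
  shows "cinner (P x) y = cinner x (P y)"
proof -
  have lin: "complex_linear P" and Im0: "\<And>x. Im (cinner (P x) x) = 0"
    using assms by (auto simp: positive_op_def complex_nonneg_Reals_iff)
  have Im_eq: "Im (cinner (P u) v) = - Im (cinner (P v) u)" for u v
    using Im0[of "u + v"] Im0[of u] Im0[of v]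
    by (simp add: blinfun.add_right cinner.add_left cinner.add_right)
  have "cinner (P x) y = cnj (cinner (P y) x)"
    using Im_eq[of x y] Im_eq[of "\<i> *\<^sub>C x" y]
    by (intro complex_eqI)
      (simp_all add: complex_linearD[OF lin] cinner_scaleC_left cinner_scaleC_right)
  then show ?thesis
    by (metis cinner_commute)
qed

text \<open>Symmetry makes the quadratic form real, so its sign can be read off the real
  part.\<close>

lemma positive_opI:
  assumes "complex_linear P" "\<And>x y. cinner (P x) y = cinner x (P y)"
    and "\<And>x. 0 \<le> Re (cinner (P x) x)"
  shows "positive_op P"
proof -
  have "Im (cinner (P x) x) = 0" for x
  proof -
    have "cinner (P x) x = cnj (cinner (P x) x)"
      using assms(2)[of x x] cinner_commute[of x "P x"] by simp
    then show ?thesis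
      by (metis cnj.simps(2) neg_equal_zero)
  qed
  then show ?thesis
    using assms by (simp add: positive_op_def complex_nonneg_Reals_iff)
qed

text \<open>Expand \<open>\<langle>P (x - P x / c), x - P x / c\<rangle> \<ge> 0\<close>.\<close>

lemma positive_op_norm_power2_le:
  assumes P: "positive_op P" and "norm P \<le> c" "0 < c"
  shows "(norm (P x))\<^sup>2 \<le> c * Re (cinner (P x) x)"
proof -
  let ?t = "1 / c"
  have "Re (cinner (P (P x)) (P x)) \<le> norm (P (P x)) * norm (P x)"
    by (rule Re_cinner_le_norm)
  also have "\<dots> \<le> (c * norm (P x)) * norm (P x)"
    using norm_blinfun[of P "P x"] \<open>norm P \<le> c\<close>
    by (meson mult_right_mono norm_ge_zero order_trans)
  finally have *: "Re (cinner (P (P x)) (P x)) \<le> c * (norm (P x))\<^sup>2"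
    by (simp add: power2_eq_square)
  have "0 \<le> Re (cinner (P (x - ?t *\<^sub>R P x)) (x - ?t *\<^sub>R P x))"
    by (rule positive_op_Re_nonneg[OF P])
  also have "\<dots> = Re (cinner (P x) x) - 2 * ?t * (norm (P x))\<^sup>2
      + ?t\<^sup>2 * Re (cinner (P (P x)) (P x))"
    using positive_op_symmetric[OF P, of "P x" x]
    by (simp add: blinfun.diff_right blinfun.scaleR_right cinner.diff_left cinner.diff_right
        cinner.scaleR_left cinner.scaleR_right Re_cinner_same power2_eq_square algebra_simps)
  also have "\<dots> \<le> Re (cinner (P x) x) - 2 * ?t * (norm (P x))\<^sup>2 + ?t\<^sup>2 * (c * (norm (P x))\<^sup>2)"
    by (intro add_left_mono mult_left_mono *) simp
  also have "\<dots> = Re (cinner (P x) x) - (norm (P x))\<^sup>2 / c"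
    using \<open>0 < c\<close> by (simp add: power2_eq_square field_simps)
  finally show ?thesis
    using \<open>0 < c\<close> by (simp add: field_simps)
qed

section \<open>Closure properties of complex-linear operators\<close>

lemma complex_linear_id: "complex_linear id_blinfun"
  by (simp add: complex_linear_def)

lemma scaleC_zero_right: "c *\<^sub>C 0 = (0 :: 'a::complex_hilbert)"
  using scaleC_add_right[of c 0 "0 :: 'a"] by simp

lemma scaleC_minus_right: "c *\<^sub>C (- x) = - (c *\<^sub>C x)"
  using scaleC_add_right[of c x "- x"] by (simp add: scaleC_zero_right eq_neg_iff_add_eq_0 add.commute)

lemma scaleC_diff_right: "c *\<^sub>C (x - y) = c *\<^sub>C x - c *\<^sub>C y"
  using scaleC_add_right[of c x "- y"] by (simp add: scaleC_minus_right)

lemma complex_linear_compose: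
  "complex_linear F \<Longrightarrow> complex_linear G \<Longrightarrow> complex_linear (F o\<^sub>L G)"
  by (simp add: complex_linear_def)

lemma complex_linear_add: "complex_linear F \<Longrightarrow> complex_linear G \<Longrightarrow> complex_linear (F + G)"
  by (simp add: complex_linear_def blinfun.add_left scaleC_add_right)

lemma complex_linear_scaleR: "complex_linear F \<Longrightarrow> complex_linear (r *\<^sub>R F)"
  by (simp add: complex_linear_def blinfun.scaleR_left scaleR_scaleC scaleC_scaleC mult.commute)

lemma complex_linear_diff: "complex_linear F \<Longrightarrow> complex_linear G \<Longrightarrow> complex_linear (F - G)"
  by (simp add: complex_linear_def blinfun.diff_left scaleC_diff_right)

lemmas complex_linear_intros =
  complex_linear_id complex_linear_compose complex_linear_add complex_linear_scaleR
  complex_linear_diff complex_linear_cadjoint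

lemma bounded_linear_scaleC: "bounded_linear (\<lambda>x :: 'a::complex_hilbert. c *\<^sub>C x)"
  by (rule bounded_linear_intro[of _ "cmod c"])
    (simp_all add: scaleC_add_right scaleR_scaleC scaleC_scaleC norm_scaleC mult.commute)

lemma complex_linear_limit:
  assumes "Y \<longlonglongrightarrow> F" "\<And>n. complex_linear (Y n)"
  shows "complex_linear F"
  unfolding complex_linear_def
proof (intro allI)
  fix c x
  have lim: "(\<lambda>n. Y n z) \<longlonglongrightarrow> F z" for z
    by (intro tendsto_intros assms)
  show "F (c *\<^sub>C x) = c *\<^sub>C F x"
    using bounded_linear.tendsto[OF bounded_linear_scaleC lim[of x], of c] lim[of "c *\<^sub>C x"]
    by (simp add: complex_linearD assms(2) LIMSEQ_unique)
qed

section \<open>The square root of a positive operator\<close>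

text \<open>
  For a positive contraction \<open>P\<close> and \<open>Q = 1 - P\<close>, the fixed point equation \<open>Y = (Q + Y\<^sup>2) / 2\<close> says
  \<open>(1 - Y)\<^sup>2 = P\<close>.  The iteration from \<open>0\<close> is dominated in norm by the same iteration for the number
  \<open>1\<close> in place of \<open>Q\<close>.
\<close>

primrec sqrt_iter :: "('a::real_normed_vector \<Rightarrow>\<^sub>L 'a) \<Rightarrow> nat \<Rightarrow> ('a \<Rightarrow>\<^sub>L 'a)" where
  "sqrt_iter Q 0 = 0"
| "sqrt_iter Q (Suc n) = (1/2) *\<^sub>R (Q + (sqrt_iter Q n o\<^sub>L sqrt_iter Q n))"

primrec sqrt_iter_bound :: "nat \<Rightarrow> real" where
  "sqrt_iter_bound 0 = 0"
| "sqrt_iter_bound (Suc n) = (1 + (sqrt_iter_bound n)\<^sup>2) / 2"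

lemma sqrt_iter_bound_nonneg: "0 \<le> sqrt_iter_bound n"
  by (induction n) auto

lemma sqrt_iter_bound_le_1: "sqrt_iter_bound n \<le> 1"
  by (induction n) (auto simp: sqrt_iter_bound_nonneg power_le_one)

lemma norm_sqrt_iter_le:
  assumes "norm Q \<le> 1"
  shows "norm (sqrt_iter Q n) \<le> sqrt_iter_bound n"
proof (induction n)
  case (Suc n)
  have "norm (sqrt_iter Q n o\<^sub>L sqrt_iter Q n) \<le> (sqrt_iter_bound n)\<^sup>2"
    unfolding power2_eq_square
    by (rule order_trans[OF norm_blinfun_compose]) (intro mult_mono Suc sqrt_iter_bound_nonneg norm_ge_zero)
  then have "norm (Q + (sqrt_iter Q n o\<^sub>L sqrt_iter Q n)) \<le> 1 + (sqrt_iter_bound n)\<^sup>2"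
    using assms by (meson add_mono norm_triangle_le)
  then show ?case by simp
qed simp

text \<open>The increments are dominated by those of the scalar sequence, by induction through a
  noncommutative difference of squares.\<close>

lemma norm_sqrt_iter_step_le:
  assumes "norm Q \<le> 1"
  shows "norm (sqrt_iter Q (Suc n) - sqrt_iter Q n) \<le> sqrt_iter_bound (Suc n) - sqrt_iter_bound n"
proof (induction n)
  case 0
  then show ?case using assms by simp
next
  case (Suc n)
  define Y Y' y y' where "Y = sqrt_iter Q n" and "Y' = sqrt_iter Q (Suc n)"
    and "y = sqrt_iter_bound n" and "y' = sqrt_iter_bound (Suc n)"
  have Y': "Y' = (1/2) *\<^sub>R (Q + (Y o\<^sub>L Y))" and y': "y' = (1 + y\<^sup>2) / 2"
    by (simp_all add: Y_def Y'_def y_def y'_def)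
  \<comment> \<open>Here \<open>Y' Y' - Y Y = Y' (Y' - Y) + (Y' - Y) Y\<close>. The scalar
    counterpart of the right side bounds it term by term.\<close>
  have "(1/2) *\<^sub>R (Q + (Y' o\<^sub>L Y')) - Y' = (1/2) *\<^sub>R ((Y' o\<^sub>L (Y' - Y)) + ((Y' - Y) o\<^sub>L Y))"
    by (subst (3) Y') (rule blinfun_eqI, simp add: blinfun.bilinear_simps algebra_simps)
  also have "norm \<dots> \<le> (1/2) * (y' * (y' - y) + (y' - y) * y)"
    unfolding norm_scaleR Y_def Y'_def y_def y'_def
    by (intro mult_mono order_trans[OF norm_triangle_ineq] add_mono
        order_trans[OF norm_blinfun_compose] norm_sqrt_iter_le[OF assms] Suc
        sqrt_iter_bound_nonneg norm_ge_zero order_trans[OF norm_ge_zero Suc])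
      auto
  also have "\<dots> = (1 + y'\<^sup>2) / 2 - y'"
    unfolding y' by (simp add: field_simps power2_eq_square)
  finally show ?case
    by (simp only: Y'_def y'_def sqrt_iter.simps(2)[of Q "Suc n"]
        sqrt_iter_bound.simps(2)[of "Suc n"])
qed

lemma convergent_sqrt_iter:
  fixes Q :: "'a::banach \<Rightarrow>\<^sub>L 'a"
  assumes "norm Q \<le> 1"
  shows "convergent (sqrt_iter Q)"
proof -
  have "incseq sqrt_iter_bound"
  proof (rule incseq_SucI)
    show "sqrt_iter_bound n \<le> sqrt_iter_bound (Suc n)" for n
      using norm_sqrt_iter_step_le[OF assms, of n] norm_ge_zero order_trans
      by (metis diff_ge_0_iff_ge)
  qed
  then obtain l where "sqrt_iter_bound \<longlonglongrightarrow> l"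
    using incseq_convergent[of sqrt_iter_bound 1] sqrt_iter_bound_le_1 by blast
  then have "summable (\<lambda>n. sqrt_iter_bound (Suc n) - sqrt_iter_bound n)"
    using telescope_sums summable_def by blast
  then have "summable (\<lambda>n. sqrt_iter Q (Suc n) - sqrt_iter Q n)"
    by (rule summable_comparison_test') (rule norm_sqrt_iter_step_le[OF assms])
  then have "convergent (\<lambda>n. \<Sum>k<n. sqrt_iter Q (Suc k) - sqrt_iter Q k)"
    by (simp add: summable_iff_convergent)
  then show ?thesis
    by (simp only: sum_lessThan_telescope) simp
qed

text \<open>The iterates are the same polynomials in \<open>Q\<close> and in \<open>Q'\<close>.
  Allowing two operators is what later gives \<open>C D = D\<^sub>* C\<close>, besides plain
  commutation.\<close>

lemma sqrt_iter_intertwine: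
  fixes Q :: "'a::real_normed_vector \<Rightarrow>\<^sub>L 'a" and Q' :: "'b::real_normed_vector \<Rightarrow>\<^sub>L 'b"
  assumes "Z o\<^sub>L Q = Q' o\<^sub>L Z"
  shows "Z o\<^sub>L sqrt_iter Q n = sqrt_iter Q' n o\<^sub>L Z"
proof (rule blinfun_eqI)
  have Q: "Z (Q x) = Q' (Z x)" for x
    using arg_cong[OF assms, of "\<lambda>F. blinfun_apply F x"] by simp
  have "Z (sqrt_iter Q n x) = sqrt_iter Q' n (Z x)" for x
  proof (induction n arbitrary: x)
    case (Suc n)
    then show ?case
      by (simp add: blinfun.bilinear_simps Q)
  qed simp
  then show "(Z o\<^sub>L sqrt_iter Q n) x = (sqrt_iter Q' n o\<^sub>L Z) x" for x
    by simp
qed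

lemma sqrt_iter_symmetric:
  fixes Q :: "'a::complex_hilbert \<Rightarrow>\<^sub>L 'a"
  assumes "\<And>x y. cinner (Q x) y = cinner x (Q y)"
  shows "cinner (sqrt_iter Q n x) y = cinner x (sqrt_iter Q n y)"
  by (induction n arbitrary: x y) (simp_all add: assms blinfun.bilinear_simps cinner.add_left cinner.add_right
      cinner.scaleR_left cinner.scaleR_right)

lemma complex_linear_sqrt_iter:
  assumes "complex_linear Q"
  shows "complex_linear (sqrt_iter Q n)"
  by (induction n) (auto intro!: complex_linear_intros assms simp: complex_linear_def[of 0] scaleC_zero_right)


section \<open>The limit of the iteration and the properties it inherits\<close>

definition sqrt_limit :: "('a::real_normed_vector \<Rightarrow>\<^sub>L 'a) \<Rightarrow> ('a \<Rightarrow>\<^sub>L 'a)"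
  where "sqrt_limit Q = lim (sqrt_iter Q)"

context
  fixes Q :: "'a::complex_hilbert \<Rightarrow>\<^sub>L 'a"
  assumes norm_Q: "norm Q \<le> 1"
begin

lemma sqrt_iter_tendsto: "sqrt_iter Q \<longlonglongrightarrow> sqrt_limit Q"
  unfolding sqrt_limit_def using convergent_sqrt_iter[OF norm_Q] by (simp add: convergent_LIMSEQ_iff)

lemma sqrt_iter_apply_tendsto: "(\<lambda>n. sqrt_iter Q n x) \<longlonglongrightarrow> sqrt_limit Q x"
  by (intro tendsto_intros sqrt_iter_tendsto)

lemma norm_sqrt_limit_le: "norm (sqrt_limit Q) \<le> 1"
proof (rule LIMSEQ_le_const2)
  show "(\<lambda>n. norm (sqrt_iter Q n)) \<longlonglongrightarrow> norm (sqrt_limit Q)"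
    by (intro tendsto_intros sqrt_iter_tendsto)
  show "\<exists>N. \<forall>n\<ge>N. norm (sqrt_iter Q n) \<le> 1"
    using norm_sqrt_iter_le[OF norm_Q] sqrt_iter_bound_le_1 order_trans by blast
qed

lemma sqrt_limit_fixpoint:
  "sqrt_limit Q = (1/2) *\<^sub>R (Q + (sqrt_limit Q o\<^sub>L sqrt_limit Q))"
proof (rule LIMSEQ_unique)
  show "(\<lambda>n. sqrt_iter Q (Suc n)) \<longlonglongrightarrow> sqrt_limit Q"
    by (rule LIMSEQ_Suc[OF sqrt_iter_tendsto])
  show "(\<lambda>n. sqrt_iter Q (Suc n)) \<longlonglongrightarrow> (1/2) *\<^sub>R (Q + (sqrt_limit Q o\<^sub>L sqrt_limit Q))"
    unfolding sqrt_iter.simps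
    by (intro tendsto_intros sqrt_iter_tendsto
        bounded_bilinear.tendsto[OF bounded_bilinear_blinfun_compose])
qed

lemma complex_linear_sqrt_limit:
  assumes "complex_linear Q"
  shows "complex_linear (sqrt_limit Q)"
  using sqrt_iter_tendsto complex_linear_sqrt_iter[OF assms] by (rule complex_linear_limit)

lemma sqrt_limit_symmetric:
  assumes "\<And>x y. cinner (Q x) y = cinner x (Q y)"
  shows "cinner (sqrt_limit Q x) y = cinner x (sqrt_limit Q y)"
proof (rule LIMSEQ_unique)
  show "(\<lambda>n. cinner (sqrt_iter Q n x) y) \<longlonglongrightarrow> cinner (sqrt_limit Q x) y"
    by (intro cinner.tendsto sqrt_iter_apply_tendsto tendsto_const)
  show "(\<lambda>n. cinner (sqrt_iter Q n x) y) \<longlonglongrightarrow> cinner x (sqrt_limit Q y)"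
    unfolding sqrt_iter_symmetric[OF assms]
    by (intro cinner.tendsto sqrt_iter_apply_tendsto tendsto_const)
qed

end

lemma sqrt_limit_intertwine:
  fixes Q :: "'a::complex_hilbert \<Rightarrow>\<^sub>L 'a" and Q' :: "'b::complex_hilbert \<Rightarrow>\<^sub>L 'b"
  assumes "norm Q \<le> 1" "norm Q' \<le> 1" "Z o\<^sub>L Q = Q' o\<^sub>L Z"
  shows "Z o\<^sub>L sqrt_limit Q = sqrt_limit Q' o\<^sub>L Z"
proof (rule LIMSEQ_unique)
  show "(\<lambda>n. Z o\<^sub>L sqrt_iter Q n) \<longlonglongrightarrow> (Z o\<^sub>L sqrt_limit Q)"
    by (intro bounded_bilinear.tendsto[OF bounded_bilinear_blinfun_compose]
        sqrt_iter_tendsto assms tendsto_const)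
  show "(\<lambda>n. Z o\<^sub>L sqrt_iter Q n) \<longlonglongrightarrow> (sqrt_limit Q' o\<^sub>L Z)"
    unfolding sqrt_iter_intertwine[OF assms(3)]
    by (intro bounded_bilinear.tendsto[OF bounded_bilinear_blinfun_compose]
        sqrt_iter_tendsto assms tendsto_const)
qed

text \<open>The square root of \<open>P\<close> obtained from that of \<open>P / c\<close>, for any
  \<open>c > 0\<close> bounding the norm. The scale stays a parameter so that two operators can be
  treated with a common one.\<close>

definition scaled_sqrt :: "real \<Rightarrow> ('a::real_normed_vector \<Rightarrow>\<^sub>L 'a) \<Rightarrow> ('a \<Rightarrow>\<^sub>L 'a)"
  where "scaled_sqrt c P = sqrt c *\<^sub>R (id_blinfun - sqrt_limit (id_blinfun - (1 / c) *\<^sub>R P))"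

text \<open>After expanding the square, \<open>positive_op_norm_power2_le\<close> shows that the
  cross term outweighs the quadratic term.\<close>

lemma norm_id_minus_positive_op_le:
  assumes P: "positive_op P" and c: "norm P \<le> c" "0 < c"
  shows "norm (id_blinfun - (1 / c) *\<^sub>R P) \<le> 1"
proof (rule norm_blinfun_bound)
  fix x
  have "(norm (x - (1 / c) *\<^sub>R P x))\<^sup>2
      = (norm x)\<^sup>2 - 2 * (1 / c) * Re (cinner (P x) x) + (1 / c)\<^sup>2 * (norm (P x))\<^sup>2"
    using norm_add_power2[of x "- ((1 / c) *\<^sub>R P x)"] Re_cinner_commute[of x "P x"]
    by (simp add: cinner.minus_right cinner.scaleR_right power_divide)
  also have "\<dots> \<le> (norm x)\<^sup>2 - 2 * (1 / c) * Re (cinner (P x) x)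
      + (1 / c)\<^sup>2 * (c * Re (cinner (P x) x))"
    by (intro add_left_mono mult_left_mono positive_op_norm_power2_le[OF P c]) simp
  also have "\<dots> = (norm x)\<^sup>2 - (1 / c) * Re (cinner (P x) x)"
    using \<open>0 < c\<close> by (simp add: power2_eq_square field_simps)
  also have "\<dots> \<le> (norm x)\<^sup>2"
    using positive_op_Re_nonneg[OF P, of x] \<open>0 < c\<close> by simp
  finally have "norm (x - (1 / c) *\<^sub>R P x) \<le> norm x"
    by (rule power2_le_imp_le) simp
  then show "norm ((id_blinfun - (1 / c) *\<^sub>R P) x) \<le> 1 * norm x"
    by (simp add: blinfun.bilinear_simps)
qed simp

lemma positive_op_scaled_sqrt:
  assumes P: "positive_op P" and c: "norm P \<le> c" "0 < c"
  shows "positive_op (scaled_sqrt c P)"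
proof -
  define Q where "Q = id_blinfun - (1 / c) *\<^sub>R P"
  have norm_Q: "norm Q \<le> 1"
    unfolding Q_def using norm_id_minus_positive_op_le[OF P c] .
  have "complex_linear Q"
    unfolding Q_def by (intro complex_linear_intros positive_op_complex_linear[OF P])
  moreover have "cinner (Q x) y = cinner x (Q y)" for x y
    by (simp add: Q_def blinfun.bilinear_simps cinner.diff_left cinner.diff_right
        cinner.scaleR_left cinner.scaleR_right positive_op_symmetric[OF P])
  ultimately have lin: "complex_linear (sqrt_limit Q)"
    and sym: "\<And>x y. cinner (sqrt_limit Q x) y = cinner x (sqrt_limit Q y)"
    using complex_linear_sqrt_limit[OF norm_Q] sqrt_limit_symmetric[OF norm_Q] by blast+
  show ?thesis
    unfolding scaled_sqrt_def Q_def[symmetric]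
  proof (rule positive_opI)
    show "complex_linear (sqrt c *\<^sub>R (id_blinfun - sqrt_limit Q))"
      by (intro complex_linear_intros lin)
  next
    fix x y
    show "cinner ((sqrt c *\<^sub>R (id_blinfun - sqrt_limit Q)) x) y
        = cinner x ((sqrt c *\<^sub>R (id_blinfun - sqrt_limit Q)) y)"
      by (simp add: blinfun.bilinear_simps cinner.diff_left cinner.diff_right
          cinner.scaleR_left cinner.scaleR_right sym)
  next
    fix x
    \<comment> \<open>Since the limit is a contraction, its quadratic form is at most that of the
      identity.\<close>
    have "Re (cinner (sqrt_limit Q x) x) \<le> norm (sqrt_limit Q x) * norm x"
      by (rule Re_cinner_le_norm)
    also have "\<dots> \<le> (1 * norm x) * norm x"
      using norm_blinfun[of "sqrt_limit Q" x] norm_sqrt_limit_le[OF norm_Q]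
      by (meson mult_right_mono norm_ge_zero order_trans)
    finally have "Re (cinner (sqrt_limit Q x) x) \<le> Re (cinner x x)"
      by (simp add: Re_cinner_same power2_eq_square)
    then show "0 \<le> Re (cinner ((sqrt c *\<^sub>R (id_blinfun - sqrt_limit Q)) x) x)"
      using \<open>0 < c\<close> by (simp add: blinfun.bilinear_simps cinner.diff_left cinner.scaleR_left)
  qed
qed

lemma scaled_sqrt_square:
  assumes P: "positive_op P" and c: "norm P \<le> c" "0 < c"
  shows "scaled_sqrt c P o\<^sub>L scaled_sqrt c P = P"
proof (rule blinfun_eqI)
  fix x
  define Q where "Q = id_blinfun - (1 / c) *\<^sub>R P"
  define Y where "Y = sqrt_limit Q"
  have "norm Q \<le> 1"
    unfolding Q_def using norm_id_minus_positive_op_le[OF P c] .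
  then have "Y = (1/2) *\<^sub>R (Q + (Y o\<^sub>L Y))"
    unfolding Y_def by (rule sqrt_limit_fixpoint)
  then have "2 *\<^sub>R Y x = 2 *\<^sub>R ((1/2) *\<^sub>R (Q + (Y o\<^sub>L Y))) x"
    by (rule arg_cong[where f = "\<lambda>F. 2 *\<^sub>R blinfun_apply F x"])
  then have YY: "Y (Y x) = 2 *\<^sub>R Y x - Q x"
    by (simp add: blinfun.bilinear_simps)
  have "(scaled_sqrt c P o\<^sub>L scaled_sqrt c P) x = c *\<^sub>R (x - 2 *\<^sub>R Y x + Y (Y x))"
    using \<open>0 < c\<close>
    by (simp add: scaled_sqrt_def Q_def[symmetric] Y_def[symmetric] blinfun.bilinear_simps
        scaleR_2 scaleR_diff_right scaleR_add_right)
  also have "\<dots> = P x"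
    using \<open>0 < c\<close> by (simp add: YY Q_def blinfun.bilinear_simps)
  finally show "(scaled_sqrt c P o\<^sub>L scaled_sqrt c P) x = P x" .
qed

lemma scaled_sqrt_intertwine:
  fixes P :: "'a::complex_hilbert \<Rightarrow>\<^sub>L 'a" and P' :: "'b::complex_hilbert \<Rightarrow>\<^sub>L 'b"
  assumes P: "positive_op P" "norm P \<le> c" and P': "positive_op P'" "norm P' \<le> c"
    and c: "0 < c" and Z: "Z o\<^sub>L P = P' o\<^sub>L Z"
  shows "Z o\<^sub>L scaled_sqrt c P = scaled_sqrt c P' o\<^sub>L Z"
proof -
  let ?Q = "id_blinfun - (1 / c) *\<^sub>R P" and ?Q' = "id_blinfun - (1 / c) *\<^sub>R P'"
  have Zx: "Z (P x) = P' (Z x)" for x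
    using arg_cong[OF Z, of "\<lambda>F. blinfun_apply F x"] by simp
  have "Z o\<^sub>L ?Q = ?Q' o\<^sub>L Z"
    by (rule blinfun_eqI) (simp add: blinfun.bilinear_simps Zx)
  then have "Z o\<^sub>L sqrt_limit ?Q = sqrt_limit ?Q' o\<^sub>L Z"
    by (intro sqrt_limit_intertwine norm_id_minus_positive_op_le assms)
  then have "Z (sqrt_limit ?Q x) = sqrt_limit ?Q' (Z x)" for x
    by (metis blinfun_apply_blinfun_compose)
  then show ?thesis
    by (intro blinfun_eqI) (simp add: scaled_sqrt_def blinfun.bilinear_simps)
qed

text \<open>\<open>S\<close> commutes with its square \<open>P\<close>, hence with the limit
  \<open>S'\<close> of polynomials in \<open>P\<close>. For \<open>y = S x - S' x\<close> this gives
  \<open>(S + S') y = 0\<close>; positivity forces \<open>S y = S' y = 0\<close>, and symmetry turns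
  \<open>cinner y y\<close> into \<open>0\<close>.\<close>

lemma positive_op_sqrt_unique:
  assumes P: "positive_op P" and c: "norm P \<le> c" "0 < c"
    and S: "positive_op S" "S o\<^sub>L S = P"
  shows "S = scaled_sqrt c P"
proof (rule blinfun_eqI)
  fix x
  define S' where "S' = scaled_sqrt c P"
  have S': "positive_op S'" "S' o\<^sub>L S' = P"
    unfolding S'_def by (rule positive_op_scaled_sqrt[OF P c] scaled_sqrt_square[OF P c])+
  have "S o\<^sub>L P = P o\<^sub>L S"
    by (rule blinfun_eqI) (simp flip: S(2))
  then have "S o\<^sub>L S' = S' o\<^sub>L S"
    unfolding S'_def by (rule scaled_sqrt_intertwine[OF P c(1) P c])
  then have comm: "S (S' y) = S' (S y)" for y
    by (metis blinfun_apply_blinfun_compose)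
  have sq: "S (S y) = S' (S' y)" for y
    using S(2) S'(2) by (metis blinfun_apply_blinfun_compose)
  \<comment> \<open>The bound of the squared norm of \<open>F y\<close> by the quadratic form; the
    summand \<open>1\<close> only makes the constant positive when \<open>F\<close> is zero.\<close>
  have null: "F y = 0" if "positive_op F" "Re (cinner (F y) y) = 0" for F :: "'a \<Rightarrow>\<^sub>L 'a" and y
    using positive_op_norm_power2_le[OF that(1), of "norm F + 1" y] that(2)
    by (simp add: add_nonneg_pos)
  define y where "y = S x - S' x"
  have "S y + S' y = 0"
    by (simp add: y_def blinfun.diff_right comm sq)
  then have "cinner (S y) y + cinner (S' y) y = 0"
    by (metis cinner.add_left cinner.zero_left)
  then have "Re (cinner (S y) y) = 0" "Re (cinner (S' y) y) = 0"
    using positive_op_Re_nonneg[OF S(1), of y] positive_op_Re_nonneg[OF S'(1), of y]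
    by (metis add_nonneg_eq_0_iff plus_complex.sel(1) zero_complex.sel(1))+
  then have "S y = 0" "S' y = 0"
    using null S(1) S'(1) by blast+
  then have "cinner y y = 0"
    using positive_op_symmetric[OF S(1), of x y] positive_op_symmetric[OF S'(1), of x y]
    by (subst (1) y_def) (simp add: cinner.diff_left)
  then show "S x = scaled_sqrt c P x"
    by (simp add: cinner_same y_def S'_def)
qed

text \<open>Existence and uniqueness resolve the definite description; in particular the choice of
  \<open>c\<close> does not affect the result.\<close>

lemma op_sqrt_eq_scaled_sqrt:
  assumes "positive_op P" "norm P \<le> c" "0 < c"
  shows "op_sqrt P = scaled_sqrt c P"
  unfolding op_sqrt_def
  by (rule the_equality)
    (use assms in \<open>blast intro: positive_op_scaled_sqrt scaled_sqrt_square positive_op_sqrt_unique\<close>)+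

lemma
  assumes "positive_op P"
  shows positive_op_op_sqrt: "positive_op (op_sqrt P)"
    and op_sqrt_square: "op_sqrt P o\<^sub>L op_sqrt P = P"
proof -
  have "op_sqrt P = scaled_sqrt (norm P + 1) P"
    by (rule op_sqrt_eq_scaled_sqrt[OF assms]) (auto simp: add_nonneg_pos)
  then show "positive_op (op_sqrt P)" "op_sqrt P o\<^sub>L op_sqrt P = P"
    using positive_op_scaled_sqrt[OF assms] scaled_sqrt_square[OF assms]
    by (auto simp: add_nonneg_pos)
qed

lemma op_sqrt_square_apply: "positive_op P \<Longrightarrow> op_sqrt P (op_sqrt P x) = P x"
  by (metis blinfun_apply_blinfun_compose op_sqrt_square)

lemma norm_op_sqrt_power2: "positive_op P \<Longrightarrow> (norm (op_sqrt P x))\<^sup>2 = Re (cinner (P x) x)"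
  by (metis Re_cinner_same op_sqrt_square_apply positive_op_op_sqrt positive_op_symmetric)

text \<open>Taking \<open>c\<close> above both norms expresses the two roots by the same iteration.
  With \<open>P = P'\<close> this is commutation with the root.\<close>

lemma op_sqrt_intertwine:
  fixes P :: "'a::complex_hilbert \<Rightarrow>\<^sub>L 'a" and P' :: "'b::complex_hilbert \<Rightarrow>\<^sub>L 'b"
    and Z :: "'a \<Rightarrow>\<^sub>L 'b"
  assumes "positive_op P" "positive_op P'" "\<And>x. Z (P x) = P' (Z x)"
  shows "Z (op_sqrt P x) = op_sqrt P' (Z x)"
proof -
  define c where "c = norm P + norm P' + 1"
  have c: "norm P \<le> c" "norm P' \<le> c" "0 < c"
    by (auto simp: c_def add_nonneg_pos)
  have "Z o\<^sub>L op_sqrt P = op_sqrt P' o\<^sub>L Z"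
    unfolding op_sqrt_eq_scaled_sqrt[OF assms(1) c(1,3)] op_sqrt_eq_scaled_sqrt[OF assms(2) c(2,3)]
    by (rule scaled_sqrt_intertwine) (auto intro!: assms c blinfun_eqI)
  then show ?thesis
    by (metis blinfun_apply_blinfun_compose)
qed

section \<open>Inverses and inverse square roots\<close>

lemma op_inverse_apply:
  assumes "invertible_op F"
  shows "F (op_inverse F x) = x" "op_inverse F (F x) = x"
proof -
  obtain G where G: "F o\<^sub>L G = id_blinfun \<and> G o\<^sub>L F = id_blinfun"
    using assms by (auto simp: invertible_op_def)
  have "F o\<^sub>L op_inverse F = id_blinfun \<and> op_inverse F o\<^sub>L F = id_blinfun"
    unfolding op_inverse_def
  proof (rule theI)
    fix G' assume "F o\<^sub>L G' = id_blinfun \<and> G' o\<^sub>L F = id_blinfun"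
    then have "G' x = G x" for x
      using G by (metis blinfun_apply_blinfun_compose blinfun_apply_id_blinfun)
    then show "G' = G" by (rule blinfun_eqI)
  qed (rule G)
  then show "F (op_inverse F x) = x" "op_inverse F (F x) = x"
    by (metis blinfun_apply_blinfun_compose blinfun_apply_id_blinfun)+
qed

lemma op_inverse_commute:
  assumes "invertible_op F" "\<And>x. Z (F x) = F (Z x)"
  shows "Z (op_inverse F x) = op_inverse F (Z x)"
  by (metis assms op_inverse_apply)

text \<open>The inverse is the root composed with the inverse of \<open>P\<close>. It is two-sided
  because these two factors commute.\<close>

lemma invertible_op_sqrt:
  assumes P: "positive_op P" and "invertible_op P"
  shows "invertible_op (op_sqrt P)"
proof -
  have "op_sqrt P (op_inverse P x) = op_inverse P (op_sqrt P x)" for x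
    by (rule op_inverse_commute[OF \<open>invertible_op P\<close>])
      (simp flip: op_sqrt_square_apply[OF P])
  then have "op_sqrt P o\<^sub>L (op_sqrt P o\<^sub>L op_inverse P) = id_blinfun"
    and "(op_sqrt P o\<^sub>L op_inverse P) o\<^sub>L op_sqrt P = id_blinfun"
    by (auto intro!: blinfun_eqI simp: op_sqrt_square_apply[OF P] op_inverse_apply[OF \<open>invertible_op P\<close>])
  then show ?thesis
    by (auto simp: invertible_op_def)
qed

context
  fixes P :: "'a::complex_hilbert \<Rightarrow>\<^sub>L 'a"
  assumes P: "positive_op P" "invertible_op P"
begin

lemma op_sqrt_op_inv_sqrt: "op_sqrt P (op_inv_sqrt P x) = x"
  unfolding op_inv_sqrt_def by (rule op_inverse_apply[OF invertible_op_sqrt[OF P]])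

lemma op_inv_sqrt_op_sqrt: "op_inv_sqrt P (op_sqrt P x) = x"
  unfolding op_inv_sqrt_def by (rule op_inverse_apply[OF invertible_op_sqrt[OF P]])

lemma op_inv_sqrt_commute:
  fixes Z :: "'a \<Rightarrow>\<^sub>L 'a"
  assumes "\<And>x. Z (P x) = P (Z x)"
  shows "Z (op_inv_sqrt P x) = op_inv_sqrt P (Z x)"
  unfolding op_inv_sqrt_def
  by (intro op_inverse_commute invertible_op_sqrt P op_sqrt_intertwine assms)

lemma complex_linear_op_inv_sqrt: "complex_linear (op_inv_sqrt P)"
  unfolding complex_linear_def
  by (metis op_sqrt_op_inv_sqrt op_inv_sqrt_op_sqrt complex_linearD positive_op_complex_linear
      positive_op_op_sqrt[OF P(1)])

end

section \<open>Powers and partial isometries\<close>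

lemma op_power_commute:
  fixes F G :: "'a::real_normed_vector \<Rightarrow>\<^sub>L 'a"
  assumes "\<And>x. F (G x) = G (F x)"
  shows "(F ^\<^sub>L n) (G x) = G ((F ^\<^sub>L n) x)"
  by (induction n) (simp_all add: assms)

lemma op_power_compose:
  fixes F G :: "'a::real_normed_vector \<Rightarrow>\<^sub>L 'a"
  assumes "\<And>x. F (G x) = G (F x)"
  shows "((F o\<^sub>L G) ^\<^sub>L n) x = (F ^\<^sub>L n) ((G ^\<^sub>L n) x)"
proof (induction n)
  case (Suc n)
  have "G ((F ^\<^sub>L n) y) = (F ^\<^sub>L n) (G y)" for y
    by (rule op_power_commute[symmetric]) (rule assms)
  then show ?case using Suc by simp
qed simp

text \<open>\<open>G\<close> is adjoint to \<open>W\<close> and a right inverse of it, so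
  \<open>x - G (W x)\<close> lies in the kernel of \<open>W\<close> and hence of \<open>F\<close>.
  For \<open>x\<close> orthogonal to that kernel, \<open>x\<close> and \<open>W x\<close> therefore
  have equal norms, and \<open>V\<close> preserves the norm.\<close>

lemma partial_isometry_factorI:
  fixes F :: "'a::complex_hilbert \<Rightarrow>\<^sub>L 'b::complex_hilbert"
    and W :: "'a \<Rightarrow> 'c::complex_hilbert"
  assumes "complex_linear F" and F: "\<And>x. F x = V (W x)"
    and V: "\<And>u. norm (V u) = norm u"
    and G: "\<And>x u. cinner (W x) u = cinner x (G u)" and WG: "\<And>u. W (G u) = u"
  shows "partial_isometry F"
  unfolding partial_isometry_def
proof (intro conjI ballI)
  fix x assume x: "x \<in> orthogonal_compl {y. F y = 0}"
  let ?y = "x - G (W x)"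
  \<comment> \<open>\<open>W\<close> is accessible only through its adjoint, so the equation is
    tested against every vector, moving \<open>W\<close> across to \<open>G\<close> and
    back.\<close>
  have "W ?y = 0"
    by (rule cinner_eqI) (simp add: G cinner.diff_left cinner.zero_left, simp add: WG flip: G)
  then have "F ?y = 0"
    using V[of "W ?y"] by (simp add: F)
  then have "cinner x ?y = 0"
    using x by (simp add: orthogonal_compl_def)
  then have "cinner x x = cinner (W x) (W x)"
    by (simp add: cinner.diff_right G)
  then have "(norm (W x))\<^sup>2 = (norm x)\<^sup>2"
    by (metis Re_cinner_same)
  then show "norm (F x) = norm x"
    by (simp add: F V)
qed fact

theorem lemma5p1:
  fixes A C B D Dstar T :: "'a::complex_hilbert \<Rightarrow>\<^sub>L 'a"
    and Tn :: "nat \<Rightarrow> ('a \<Rightarrow>\<^sub>L 'a)"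
    and R :: "('a \<times> 'a) \<Rightarrow>\<^sub>L ('a \<times> 'a)"
  assumes "complex_linear A" and "complex_linear C"
    and "A o\<^sub>L C = C o\<^sub>L A"
    and "positive_op A" and "invertible_op A"
    and "norm C \<le> 1"
    and "invertible_op (id_blinfun + (A o\<^sub>L (A - 2 *\<^sub>R id_blinfun) o\<^sub>L cadjoint C o\<^sub>L C))"
    and "B = op_inv_sqrt (id_blinfun + (A o\<^sub>L (A - 2 *\<^sub>R id_blinfun) o\<^sub>L cadjoint C o\<^sub>L C))"
    and "D = op_sqrt (id_blinfun - (cadjoint C o\<^sub>L C))"
    and "Dstar = op_sqrt (id_blinfun - (C o\<^sub>L cadjoint C))"
    and "T = A o\<^sub>L B o\<^sub>L D o\<^sub>L C"
    and "\<And>n. n \<ge> 1 \<Longrightarrow> Tn n = op_inv_sqrt A o\<^sub>L T ^\<^sub>L n o\<^sub>L op_inv_sqrt A"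
    and "R = block_op
      (B o\<^sub>L D o\<^sub>L C) (B o\<^sub>L D o\<^sub>L Dstar)
      ((A - id_blinfun) o\<^sub>L C o\<^sub>L B o\<^sub>L C) ((A - id_blinfun) o\<^sub>L C o\<^sub>L B o\<^sub>L Dstar)"
  shows "(\<forall>n\<ge>1. Tn n = A ^\<^sub>L (n - 1) o\<^sub>L (B o\<^sub>L D o\<^sub>L C) ^\<^sub>L n)
    \<and> partial_isometry R
    \<and> (\<forall>n\<ge>1. \<forall>h. proj_first ((R ^\<^sub>L n) (h, 0)) = (Tn n h, 0))"
proof -
  note A = assms(1) and C = assms(2) and posA = assms(4) and invA = assms(5)
  define X where "X = id_blinfun + (A o\<^sub>L (A - 2 *\<^sub>R id_blinfun) o\<^sub>L cadjoint C o\<^sub>L C)"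
  define N where "N = id_blinfun - (cadjoint C o\<^sub>L C)"
  define M where "M = id_blinfun - (C o\<^sub>L cadjoint C)"
  define E where "E = A - id_blinfun"
  define K where "K = (B o\<^sub>L D o\<^sub>L C)"
  have B: "B = op_inv_sqrt X" and D: "D = op_sqrt N" and Dstar: "Dstar = op_sqrt M"
    and invX: "invertible_op X"
    using assms(7-10) by (simp_all add: X_def N_def M_def)

  note cinner_simps = cinner.add_left cinner.add_right cinner.diff_left cinner.diff_right
    cinner_cadjoint[OF C] cinner_cadjoint'[OF C]
  have symA: "cinner (A x) y = cinner x (A y)" for x y
    by (rule positive_op_symmetric[OF posA])
  have AC: "A (C x) = C (A x)" for x
    using assms(3) by (metis blinfun_apply_blinfun_compose)
  have AC': "A (cadjoint C x) = cadjoint C (A x)" for x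
    by (rule cinner_eqI') (metis symA AC cinner_cadjoint[OF C])
  have N_apply: "N x = x - cadjoint C (C x)" for x
    by (simp add: N_def blinfun.bilinear_simps)
  have M_apply: "M x = x - C (cadjoint C x)" for x
    by (simp add: M_def blinfun.bilinear_simps)
  have E_apply: "E x = A x - x" for x
    by (simp add: E_def blinfun.bilinear_simps)
  \<comment> \<open>The decisive form of \<open>X\<close>:
    \<open>A (A - 2 I) = E\<^sup>2 - I\<close>, and \<open>A\<close> can be moved past
    \<open>cadjoint C\<close>.\<close>
  have X_apply: "X x = N x + cadjoint C (E (E (C x)))" for x
    by (simp add: X_def N_apply E_apply blinfun.bilinear_simps AC AC' scaleR_2)
  have symE: "cinner (E x) y = cinner x (E y)" for x y
    by (simp add: E_apply cinner_simps symA)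

  have C_le: "norm (C x) \<le> norm x" for x
    using norm_blinfun[of C x] assms(6) mult_right_mono[of "norm C" 1 "norm x"] by simp
  have C'_le: "norm (cadjoint C x) \<le> norm x" for x
    using norm_cadjoint_apply_le[OF C, of x] assms(6) mult_right_mono[of "norm C" 1 "norm x"] by simp
  have posN: "positive_op N"
  proof (rule positive_opI)
    show "complex_linear N"
      unfolding N_def by (intro complex_linear_intros C)
    show "cinner (N x) y = cinner x (N y)" for x y
      by (simp add: N_apply cinner_simps)
    show "0 \<le> Re (cinner (N x) x)" for x
      using C_le[of x] by (simp add: N_apply cinner_simps Re_cinner_same power_mono flip: cinner_cadjoint[OF C])
  qed
  have posM: "positive_op M"
  proof (rule positive_opI)
    show "complex_linear M"
      unfolding M_def by (intro complex_linear_intros C)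
    show "cinner (M x) y = cinner x (M y)" for x y
      by (simp add: M_apply cinner_simps)
    show "0 \<le> Re (cinner (M x) x)" for x
      using C'_le[of x] by (simp add: M_apply cinner.diff_left cinner_cadjoint[OF C] Re_cinner_same power_mono)
  qed
  \<comment> \<open>This identity serves twice: for the positivity of \<open>X\<close>, and for the
    norm of the column \<open>V\<close>.\<close>
  have X_norms: "Re (cinner (X x) x) = Re (cinner (N x) x) + (norm (E (C x)))\<^sup>2" for x
    by (simp add: X_apply cinner.add_left cinner_cadjoint'[OF C] symE flip: Re_cinner_same)
  have posX: "positive_op X"
  proof (rule positive_opI)
    show "complex_linear X"
      unfolding X_def by (intro complex_linear_intros A C)
    show "cinner (X x) y = cinner x (X y)" for x y
      by (simp add: X_apply cinner.add_left cinner.add_right positive_op_symmetric[OF posN]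
          cinner_cadjoint'[OF C] symE flip: cinner_cadjoint[OF C])
    show "0 \<le> Re (cinner (X x) x)" for x
      using positive_op_Re_nonneg[OF posN] by (simp add: X_norms)
  qed

  have AD: "A (D x) = D (A x)" for x
    unfolding D by (intro op_sqrt_intertwine posN) (simp add: N_apply AC AC' blinfun.bilinear_simps)
  have ADstar: "A (Dstar x) = Dstar (A x)" for x
    unfolding Dstar by (intro op_sqrt_intertwine posM) (simp add: M_apply AC AC' blinfun.bilinear_simps)
  \<comment> \<open>The root intertwines because \<open>C N = M C\<close>, both sides being
    \<open>C - C C\<^sup>* C\<close>.\<close>
  have CD: "C (D x) = Dstar (C x)" for x
    unfolding D Dstar
    by (intro op_sqrt_intertwine posN posM) (simp add: N_apply M_apply blinfun.bilinear_simps)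
  have AB: "A (B x) = B (A x)" for x
    unfolding B by (intro op_inv_sqrt_commute posX invX)
      (simp add: X_apply N_apply E_apply AC AC' blinfun.bilinear_simps)
  \<comment> \<open>\<open>X\<close> commutes with \<open>N\<close> because \<open>A\<close>
    commutes with \<open>C\<close> and its adjoint, which makes \<open>X\<close> a polynomial in
    \<open>A\<close> and \<open>C\<^sup>* C\<close>.\<close>
  have XD: "X (D x) = D (X x)" for x
    unfolding D by (intro op_sqrt_intertwine posN)
      (simp add: X_apply N_apply E_apply AC AC' blinfun.bilinear_simps)
  have DB: "D (B x) = B (D x)" for x
    unfolding B by (intro op_inv_sqrt_commute posX invX) (simp add: XD)

  have K_apply: "K x = B (D (C x))" for x
    by (simp add: K_def)
  have KA: "K (A x) = A (K x)" for x
    by (simp add: K_apply AC AB AD)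
  \<comment> \<open>Writing the index as \<open>Suc n\<close> turns the exponent
    \<open>n - 1\<close> into \<open>n\<close>. \<open>T\<close> is the product of the commuting
    operators \<open>A\<close> and \<open>K\<close>, and the two factors \<open>?S\<close>, brought
    together, cancel exactly one \<open>A\<close>.\<close>
  have Tn: "Tn (Suc n) h = (A ^\<^sub>L n) ((K ^\<^sub>L Suc n) h)" for n h
  proof -
    let ?S = "op_inv_sqrt A"
    have T: "T = A o\<^sub>L K"
      unfolding assms(11) by (rule blinfun_eqI) (simp add: K_apply)
    have SA: "?S (A x) = A (?S x)" for x
      by (rule op_inv_sqrt_commute[OF posA invA, symmetric]) simp
    have SK: "K (?S x) = ?S (K x)" for x
      by (rule op_inv_sqrt_commute[OF posA invA]) (rule KA)
    have ST: "(T ^\<^sub>L m) (?S x) = ?S ((T ^\<^sub>L m) x)" for m x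
      by (rule op_power_commute) (simp add: T SK SA)
    have "Tn (Suc n) = ?S o\<^sub>L T ^\<^sub>L Suc n o\<^sub>L ?S"
      by (rule assms(12)) simp
    then have "Tn (Suc n) h = ?S (?S ((T ^\<^sub>L Suc n) h))"
      by (simp only: blinfun_apply_blinfun_compose ST)
    also have "(T ^\<^sub>L Suc n) h = A ((A ^\<^sub>L n) ((K ^\<^sub>L Suc n) h))"
      unfolding T by (subst op_power_compose) (simp_all add: KA)
    also have "?S (?S (A y)) = y" for y
      by (simp add: op_inv_sqrt_op_sqrt[OF posA invA] flip: op_sqrt_square_apply[OF posA])
    finally show ?thesis .
  qed

  define V where "V u = (B (D u), E (C (B u)))" for u
  define W where "W z = C (fst z) + Dstar (snd z)" for z
  have R: "R z = V (W z)" for z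
    by (cases z) (simp add: assms(13) V_def W_def E_def block_op_apply blinfun.bilinear_simps)
  have linDs: "complex_linear Dstar" and linD: "complex_linear D"
    unfolding D Dstar by (intro positive_op_complex_linear positive_op_op_sqrt posN posM)+
  have linB: "complex_linear B"
    unfolding B by (rule complex_linear_op_inv_sqrt[OF posX invX])
  have linE: "complex_linear E"
    unfolding E_def by (intro complex_linear_intros A)
  \<comment> \<open>\<open>G\<close> is the adjoint column of the row \<open>W\<close>, as
    \<open>Dstar\<close> is self-adjoint.\<close>
  have "partial_isometry R"
  proof (rule partial_isometry_factorI[where G = "\<lambda>u. (cadjoint C u, Dstar u)"])
    show "complex_linear R"
      unfolding complex_linear_def
      by (simp add: R V_def W_def scaleC_prod_def complex_linearD linB linD linDs linE C
          scaleC_add_right[symmetric])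
    show "norm (V u) = norm u" for u
    proof -
      \<comment> \<open>Since \<open>D\<close> and \<open>B\<close> commute, both components are
        evaluated at \<open>B u\<close>, where \<open>X_norms\<close> adds them up to the quadratic
        form of \<open>X\<close>; then \<open>B\<close> cancels the root of
        \<open>X\<close>.\<close>
      have "(norm (V u))\<^sup>2 = (norm (D (B u)))\<^sup>2 + (norm (E (C (B u))))\<^sup>2"
        by (simp add: V_def norm_prod_def DB)
      also have "\<dots> = (norm (op_sqrt X (B u)))\<^sup>2"
        by (simp add: D norm_op_sqrt_power2 posN posX X_norms)
      also have "\<dots> = (norm u)\<^sup>2"
        by (simp add: B op_sqrt_op_inv_sqrt[OF posX invX])
      finally show ?thesis by simp
    qed
    show "cinner (W z) u = cinner z (cadjoint C u, Dstar u)" for z u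
      using positive_op_symmetric[OF positive_op_op_sqrt[OF posM]]
      by (simp add: W_def cinner_prod_def cinner.add_left cinner_cadjoint[OF C] Dstar)
    show "W (cadjoint C u, Dstar u) = u" for u
      by (simp add: W_def Dstar op_sqrt_square_apply[OF posM] M_apply)
  qed (rule R)

  \<comment> \<open>Both summands contain \<open>C B D u\<close>: the first is it, and the second is
    \<open>E\<close> applied to it after moving \<open>Dstar\<close> inward. Then
    \<open>I + E = A\<close>.\<close>
  have WV: "W (V u) = A (C (B (D u)))" for u
    by (simp add: W_def V_def E_apply blinfun.bilinear_simps ADstar[symmetric] DB[symmetric] CD)
  \<comment> \<open>The powers of \<open>A C B D\<close> are regrouped with \<open>A\<close> in
    front and \<open>K = B D C\<close> behind a single \<open>C\<close>. The base case is
    \<open>W (h, 0) = C h\<close>.\<close>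
  have R_pow: "(R ^\<^sub>L Suc n) (h, 0) = V ((A ^\<^sub>L n) (C ((K ^\<^sub>L n) h)))" for n h
  proof (induction n)
    case 0
    then show ?case by (simp add: R W_def)
  next
    case (Suc n)
    have "(A ^\<^sub>L n) (C y) = C ((A ^\<^sub>L n) y)" "(A ^\<^sub>L n) (K y) = K ((A ^\<^sub>L n) y)" for y
      by (rule op_power_commute, simp add: AC KA)+
    then have "W (V ((A ^\<^sub>L n) (C ((K ^\<^sub>L n) h)))) = (A ^\<^sub>L Suc n) (C ((K ^\<^sub>L Suc n) h))"
      by (simp add: WV flip: K_apply)
    then show ?case
      using Suc by (simp add: R)
  qed
  \<comment> \<open>The first component of \<open>V\<close> supplies the factor \<open>B D\<close>
    that completes the remaining \<open>C\<close> to one more \<open>K\<close>.\<close>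
  have "fst (V ((A ^\<^sub>L n) (C y))) = (A ^\<^sub>L n) (K y)" for n y
  proof -
    have "(A ^\<^sub>L n) (C y) = C ((A ^\<^sub>L n) y)" "(A ^\<^sub>L n) (K y) = K ((A ^\<^sub>L n) y)"
      by (rule op_power_commute, simp add: AC KA)+
    then show ?thesis
      by (simp add: V_def K_apply)
  qed
  moreover have "(K ^\<^sub>L n) (K h) = K ((K ^\<^sub>L n) h)" for n h
    by (rule op_power_commute) simp
  ultimately have "proj_first ((R ^\<^sub>L Suc n) (h, 0)) = (Tn (Suc n) h, 0)" for n h
    unfolding R_pow Tn by (cases "V ((A ^\<^sub>L n) (C ((K ^\<^sub>L n) h)))")
      (metis fst_conv proj_first_apply op_power.simps(2) blinfun_apply_blinfun_compose)
  moreover have "Tn (Suc n) = A ^\<^sub>L n o\<^sub>L K ^\<^sub>L Suc n" for n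
    by (rule blinfun_eqI) (simp only: Tn blinfun_apply_blinfun_compose)
  ultimately show ?thesis
    using \<open>partial_isometry R\<close> unfolding K_def
    by (metis Suc_le_D One_nat_def diff_Suc_1)
qed

end
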